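(* Let $\mathcal{N}$ be the manifold of Gaussian densities over $\mathbb{R}$ and let $T\mathcal{N}$ be endowed with the Kähler structure $(g,J,\omega)$ associated to $(h_F,\nabla^{(e)})$ (Fisher metric and exponential connection) via Dombrowski's construction. Then, as a Kähler manifold, $T\mathcal{N}$ is (isomorphic to) the Siegel-Jacobi space $\mathbb{S}^J=(\mathbb{H}\times\mathbb{C},g_{KB})$; that is, there is a biholomorphic isometry $T\mathcal{N}\cong\mathbb{S}^{J}$.
   Context: $\mathcal{N}$ is the set of densities $p(x;\mu,\sigma)=\frac{1}{\sqrt{2\pi}\sigma}\exp\{-\frac{(x-\mu)^2}{2\sigma^2}\}$ ($x\in\mathbb{R}$), $\mu\in\mathbb{R}$, $\sigma>0$; it is a 2-dimensional manifold with global coordinates $(\mu,\sigma)$. For a coordinate system $\xi=(\xi_1,\xi_2)$ on $\mathcal{N}$ with $\partial_i=\partial/\partial\xi_i$, the Fisher metric is $h_F(\partial_i,\partial_j)=\mathbb{E}_{p_\xi}[\partial_i\ln p_\xi\cdot\partial_j\ln p_\xi]$ and the exponential connection $\nabla^{(e)}$ is defined by $h_F(\nabla^{(e)}_{\partial_i}\partial_j,\partial_k)=\mathbb{E}_{p_\xi}[\partial_i\partial_j\ln p_\xi\cdot\partial_k\ln p_\xi]$, where $\mathbb{E}_{p_\xi}$ is the expectation with respect to $p_\xi(x)dx$. Dombrowski's construction: let $M$ be a manifold with a Riemannian metric $h$ and an affine connection $\nabla$; let $\pi:TM\to M$ be the canonical projection and $K:T(TM)\to TM$ the connector of $\nabla$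 (the unique map with $\nabla_XY=K\,Y_*X$ for all vector fields $X,Y$). Identify $A\in T_{u}(TM)$, $u\in T_pM$, with the triple $(u,v,w)=(u,\pi_*A,KA)$, $v,w\in T_pM$. Then $g_u((u,v,w),(u,\bar v,\bar w))=h_p(v,\bar v)+h_p(w,\bar w)$, $J_u(u,v,w)=(u,-w,v)$, $\omega=g(J\cdot,\cdot)$. For $(h_F,\nabla^{(e)})$ on $\mathcal{N}$ this structure on $T\mathcal{N}$ is Kähler. $\mathbb{H}=\{\tau\in\mathbb{C}\mid\mathrm{Im}(\tau)>0\}$. The Siegel-Jacobi space $\mathbb{S}^J$ is the complex manifold $\mathbb{H}\times\mathbb{C}$ with the Kähler metric $g_{KB}=\tfrac12 g_{1,1}$ where, with $\tau=u+iv\in\mathbb{H}$, $z=x+iy\in\mathbb{C}$, the matrix of $g_{1,1}$ in the coordinates $(u,v,x,y)$ is $$\begin{bmatrix}\frac{v+y^2}{v^3}&0&-\frac{y}{v^2}&0\\0&\frac{v+y^2}{v^3}&0&-\frac{y}{v^2}\\-\frac{y}{v^2}&0&\frac1v&0\\0&-\frac{y}{v^2}&0&\frac1v\end{bmatrix}.$$ *)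

theory Defs
  imports "HOL-Probability.Probability"
begin

text \<open>
  All manifolds below carry a global coordinate system, so they are treated in coordinates: a
  manifold is an open subset \<open>U\<close> of a Euclidean space, all its tangent spaces are the ambient
  space, and its tangent bundle is \<open>U \<times> UNIV\<close>, whose elements are pairs (base point, vector).
  The coordinate vector fields are the constant fields with value in \<^const>\<open>Basis\<close>.
\<close>


section \<open>Smooth maps\<close>

primrec Ck_on :: "nat \<Rightarrow> 'a::real_normed_vector set \<Rightarrow> ('a \<Rightarrow> 'b::real_normed_vector) \<Rightarrow> bool" where
  "Ck_on 0 S f \<longleftrightarrow> continuous_on S f"
| "Ck_on (Suc k) S f \<longleftrightarrow>
     (\<forall>x\<in>S. f differentiable (at x)) \<and> (\<forall>v. Ck_on k S (\<lambda>x. frechet_derivative f (at x) v))"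

text \<open>Only meant for open \<open>S\<close>.\<close>

definition smooth_on :: "'a::real_normed_vector set \<Rightarrow> ('a \<Rightarrow> 'b::real_normed_vector) \<Rightarrow> bool" where
  "smooth_on S f \<longleftrightarrow> (\<forall>k. Ck_on k S f)"

definition diffeomorphism ::
    "'a::real_normed_vector set \<Rightarrow> 'b::real_normed_vector set \<Rightarrow> ('a \<Rightarrow> 'b) \<Rightarrow> bool" where
  "diffeomorphism U V G \<longleftrightarrow>
     bij_betw G U V \<and> smooth_on U G \<and> smooth_on V (the_inv_into U G)"


section \<open>Affine connections\<close>

text \<open>A connection \<open>\<nabla>\<close> maps vector fields \<open>X\<close>, \<open>Y\<close> to \<open>\<nabla>\<^sub>X Y\<close>. Its values outside \<open>U\<close>, or on fields
  that are not smooth on \<open>U\<close>, are irrelevant.\<close>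

type_synonym 'a connection = "('a \<Rightarrow> 'a) \<Rightarrow> ('a \<Rightarrow> 'a) \<Rightarrow> ('a \<Rightarrow> 'a)"

definition affine_connection :: "'a::euclidean_space set \<Rightarrow> 'a connection \<Rightarrow> bool" where
  "affine_connection U nabla \<longleftrightarrow>
     (\<forall>X Y. smooth_on U X \<longrightarrow> smooth_on U Y \<longrightarrow> smooth_on U (nabla X Y)) \<and>
     (\<forall>X X' Y. smooth_on U X \<longrightarrow> smooth_on U X' \<longrightarrow> smooth_on U Y \<longrightarrow>
        (\<forall>p\<in>U. nabla (\<lambda>q. X q + X' q) Y p = nabla X Y p + nabla X' Y p)) \<and>
     (\<forall>X Y Y'. smooth_on U X \<longrightarrow> smooth_on U Y \<longrightarrow> smooth_on U Y' \<longrightarrow>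
        (\<forall>p\<in>U. nabla X (\<lambda>q. Y q + Y' q) p = nabla X Y p + nabla X Y' p)) \<and>
     (\<forall>(f::'a \<Rightarrow> real) X Y. smooth_on U f \<longrightarrow> smooth_on U X \<longrightarrow> smooth_on U Y \<longrightarrow>
        (\<forall>p\<in>U. nabla (\<lambda>q. f q *\<^sub>R X q) Y p = f p *\<^sub>R nabla X Y p \<and>
               nabla X (\<lambda>q. f q *\<^sub>R Y q) p =
                 frechet_derivative f (at p) (X p) *\<^sub>R Y p + f p *\<^sub>R nabla X Y p))"

text \<open>
  The connector \<open>K : T(TM) \<rightarrow> TM\<close>, restricted to the tangent space of \<open>TM\<close> at \<open>(p, u)\<close>. In the
  coordinates of \<open>TM\<close> that space is \<open>'a \<times> 'a\<close>, and \<open>Y\<^sub>* X\<close> at \<open>p\<close> is the derivative of the section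
  \<open>q \<mapsto> (q, Y q)\<close> applied to \<open>X p\<close>. Linearity on fibres, which is part of the notion of a
  connector, is needed for uniqueness: no nonzero vertical vector is of the form \<open>Y\<^sub>* X\<close>.
\<close>

definition connector ::
    "'a::euclidean_space set \<Rightarrow> 'a connection \<Rightarrow> 'a \<times> 'a \<Rightarrow> ('a \<times> 'a \<Rightarrow> 'a)" where
  "connector U nabla = (\<lambda>(p, u). THE K. linear K \<and>
     (\<forall>X Y. smooth_on U X \<longrightarrow> smooth_on U Y \<longrightarrow> Y p = u \<longrightarrow>
        nabla X Y p = K (frechet_derivative (\<lambda>q. (q, Y q)) (at p) (X p))))"


section \<open>Dombrowski's construction\<close>

text \<open>A tangent vector \<open>A\<close> of \<open>TM\<close> at \<open>(p, u)\<close> corresponds to the triple \<open>(u, v, w)\<close> with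
  \<open>v = \<pi>\<^sub>* A = fst A\<close> and \<open>w = K A\<close>.\<close>

definition dombrowski_metric ::
    "'a::euclidean_space set \<Rightarrow> ('a \<Rightarrow> 'a \<Rightarrow> 'a \<Rightarrow> real) \<Rightarrow> 'a connection \<Rightarrow>
     ('a \<times> 'a \<Rightarrow> 'a \<times> 'a \<Rightarrow> 'a \<times> 'a \<Rightarrow> real)" where
  "dombrowski_metric U h nabla = (\<lambda>(p, u) A B.
     h p (fst A) (fst B) + h p (connector U nabla (p, u) A) (connector U nabla (p, u) B))"

definition dombrowski_J ::
    "'a::euclidean_space set \<Rightarrow> 'a connection \<Rightarrow> ('a \<times> 'a \<Rightarrow> 'a \<times> 'a \<Rightarrow> 'a \<times> 'a)" where
  "dombrowski_J U nabla = (\<lambda>(p, u) A. THE B.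
     fst B = - connector U nabla (p, u) A \<and> connector U nabla (p, u) B = fst A)"


section \<open>Fisher metric and exponential connection\<close>

text \<open>A family of probability densities on the real line, parametrised by \<open>\<xi> \<in> U\<close>.\<close>

type_synonym 'a family = "'a \<Rightarrow> real \<Rightarrow> real"

definition expect :: "'a family \<Rightarrow> 'a \<Rightarrow> (real \<Rightarrow> real) \<Rightarrow> real" where
  "expect p \<xi> f = (LINT x | density lborel (\<lambda>x. ennreal (p \<xi> x)). f x)"

text \<open>\<open>\<partial>\<^sub>i ln p\<^sub>\<xi>(x)\<close> and \<open>\<partial>\<^sub>i \<partial>\<^sub>j ln p\<^sub>\<xi>(x)\<close>, for basis vectors \<open>i\<close>, \<open>j\<close> of the parameter space.\<close>

definition dlog :: "'a::euclidean_space family \<Rightarrow> 'a \<Rightarrow> 'a \<Rightarrow> real \<Rightarrow> real" where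
  "dlog p i \<xi> x = frechet_derivative (\<lambda>\<eta>. ln (p \<eta> x)) (at \<xi>) i"

definition ddlog :: "'a::euclidean_space family \<Rightarrow> 'a \<Rightarrow> 'a \<Rightarrow> 'a \<Rightarrow> real \<Rightarrow> real" where
  "ddlog p i j \<xi> x = frechet_derivative (\<lambda>\<eta>. dlog p j \<eta> x) (at \<xi>) i"

definition fisher_metric :: "'a::euclidean_space family \<Rightarrow> 'a \<Rightarrow> 'a \<Rightarrow> 'a \<Rightarrow> real" where
  "fisher_metric p \<xi> v w =
     (\<Sum>i\<in>Basis. \<Sum>j\<in>Basis. (v \<bullet> i) * (w \<bullet> j) * expect p \<xi> (\<lambda>x. dlog p i \<xi> x * dlog p j \<xi> x))"

definition is_exponential_connection ::
    "'a::euclidean_space set \<Rightarrow> 'a family \<Rightarrow> 'a connection \<Rightarrow> bool" where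
  "is_exponential_connection U p nabla \<longleftrightarrow>
     affine_connection U nabla \<and>
     (\<forall>\<xi>\<in>U. \<forall>i\<in>Basis. \<forall>j\<in>Basis. \<forall>k\<in>Basis.
        fisher_metric p \<xi> (nabla (\<lambda>_. i) (\<lambda>_. j) \<xi>) k =
        expect p \<xi> (\<lambda>x. ddlog p i j \<xi> x * dlog p k \<xi> x))"

text \<open>Where the Fisher metric is nondegenerate, the defining equations and the Leibniz rule
  determine \<open>\<nabla>\<^sub>X Y\<close> on \<open>U\<close> for all smooth \<open>X\<close>, \<open>Y\<close>; the choice only concerns irrelevant values.\<close>

definition exponential_connection :: "'a::euclidean_space set \<Rightarrow> 'a family \<Rightarrow> 'a connection" where
  "exponential_connection U p = (SOME nabla. is_exponential_connection U p nabla)"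


section \<open>The Gaussian family and its tangent bundle\<close>

definition gaussians :: "(real \<Rightarrow> real) set" where
  "gaussians = {normal_density \<mu> \<sigma> | \<mu> \<sigma>. \<sigma> > 0}"

definition gauss :: "(real \<times> real) family" where
  "gauss = (\<lambda>(\<mu>, \<sigma>). normal_density \<mu> \<sigma>)"

definition gauss_dom :: "(real \<times> real) set" where
  "gauss_dom = {(\<mu>, \<sigma>). \<sigma> > 0}"

text \<open>A tangent vector of the manifold of Gaussian densities is a density together with the
  components of the vector in the frame \<open>\<partial>/\<partial>\<mu>\<close>, \<open>\<partial>/\<partial>\<sigma>\<close>.\<close>

definition T_gaussians :: "((real \<Rightarrow> real) \<times> (real \<times> real)) set" where
  "T_gaussians = gaussians \<times> UNIV"

definition T_gauss :: "(real \<times> real) \<times> (real \<times> real) \<Rightarrow> (real \<Rightarrow> real) \<times> (real \<times> real)" where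
  "T_gauss = (\<lambda>(\<xi>, u). (gauss \<xi>, u))"

definition T_gauss_dom :: "((real \<times> real) \<times> (real \<times> real)) set" where
  "T_gauss_dom = gauss_dom \<times> UNIV"

definition T_gauss_metric ::
    "(real \<times> real) \<times> (real \<times> real) \<Rightarrow> (real \<times> real) \<times> (real \<times> real) \<Rightarrow>
     (real \<times> real) \<times> (real \<times> real) \<Rightarrow> real" where
  "T_gauss_metric =
     dombrowski_metric gauss_dom (fisher_metric gauss) (exponential_connection gauss_dom gauss)"

definition T_gauss_J ::
    "(real \<times> real) \<times> (real \<times> real) \<Rightarrow> (real \<times> real) \<times> (real \<times> real) \<Rightarrow>
     (real \<times> real) \<times> (real \<times> real)" where
  "T_gauss_J = dombrowski_J gauss_dom (exponential_connection gauss_dom gauss)"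


section \<open>The Siegel-Jacobi space\<close>

definition siegel_jacobi :: "(complex \<times> complex) set" where
  "siegel_jacobi = {\<tau>. Im \<tau> > 0} \<times> UNIV"

definition real_coords :: "complex \<times> complex \<Rightarrow> real ^ 4" where
  "real_coords = (\<lambda>(a, b). vector [Re a, Im a, Re b, Im b])"

definition g11_matrix :: "complex \<times> complex \<Rightarrow> real ^ 4 ^ 4" where
  "g11_matrix = (\<lambda>(\<tau>, z). let v = Im \<tau>; y = Im z in
     vector [vector [(v + y\<^sup>2) / v^3, 0, - y / v\<^sup>2, 0],
             vector [0, (v + y\<^sup>2) / v^3, 0, - y / v\<^sup>2],
             vector [- y / v\<^sup>2, 0, 1 / v, 0],
             vector [0, - y / v\<^sup>2, 0, 1 / v]])"

definition g_KB ::
    "complex \<times> complex \<Rightarrow> complex \<times> complex \<Rightarrow> complex \<times> complex \<Rightarrow> real" where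
  "g_KB q A B = 1/2 * (real_coords A \<bullet> (g11_matrix q *v real_coords B))"

definition J_SJ :: "complex \<times> complex \<Rightarrow> complex \<times> complex \<Rightarrow> complex \<times> complex" where
  "J_SJ q = (\<lambda>(a, b). (\<i> * a, \<i> * b))"


section \<open>Isomorphisms of Kaehler manifolds\<close>

definition kaehler_form :: "('a \<Rightarrow> 'a \<Rightarrow> 'a \<Rightarrow> real) \<Rightarrow> ('a \<Rightarrow> 'a \<Rightarrow> 'a) \<Rightarrow> ('a \<Rightarrow> 'a \<Rightarrow> 'a \<Rightarrow> real)" where
  "kaehler_form g J q A B = g q (J q A) B"

text \<open>A diffeomorphism is holomorphic in both directions iff its differential intertwines the
  complex structures. Preservation of the Kaehler form is a consequence of the other conditions,
  listed for completeness.\<close>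

definition biholomorphic_isometry ::
    "'a::real_normed_vector set \<Rightarrow> ('a \<Rightarrow> 'a \<Rightarrow> 'a \<Rightarrow> real) \<Rightarrow> ('a \<Rightarrow> 'a \<Rightarrow> 'a) \<Rightarrow>
     'b::real_normed_vector set \<Rightarrow> ('b \<Rightarrow> 'b \<Rightarrow> 'b \<Rightarrow> real) \<Rightarrow> ('b \<Rightarrow> 'b \<Rightarrow> 'b) \<Rightarrow>
     ('a \<Rightarrow> 'b) \<Rightarrow> bool" where
  "biholomorphic_isometry U g J V g' J' G \<longleftrightarrow>
     diffeomorphism U V G \<and>
     (\<forall>q\<in>U. let D = frechet_derivative G (at q) in
        (\<forall>A. D (J q A) = J' (G q) (D A)) \<and>
        (\<forall>A B. g' (G q) (D A) (D B) = g q A B) \<and>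
        (\<forall>A B. kaehler_form g' J' (G q) (D A) (D B) = kaehler_form g J q A B))"

end

(* The natural parameters t1 = mu/sigma^2 and t2 = -1/(2 sigma^2) are affine coordinates of the
   exponential connection, so t_k + i dt_k(u) are holomorphic coordinates of Dombrowski's complex
   structure at a tangent vector u. The isomorphism is tau = -i (t2 + i dt2(u)) and
   z = i (t1 + i dt1(u)); for u = (a, b) this reads
     tau = b/sigma^3 + i/(2 sigma^2),   z = (2 mu b/sigma^3 - a/sigma^2) + i mu/sigma^2.
   The Fisher metric diag(1, 2)/sigma^2 and the Christoffel symbols of the exponential connection
   come from the Gaussian moments up to order four, and the isometry is then an algebraic
   identity. *)
theory Submission
  imports Defs
begin

section \<open>Calculus of smooth maps\<close>

text \<open>In affine coordinates the Christoffel symbols vanish, so the differential of t_k + i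
  dt_k(u) sends a tangent vector with base part v and connector part w to dt_k(v) + i dt_k(w).
  Replacing (v, w) by (-w, v) multiplies this by i. The factor -i in tau makes Im tau = -t2
  positive. The metrics match because the Fisher metric in (t1, t2) is the Hessian of the
  log-partition function -t1^2/(4 t2) - ln(-t2)/2 + const. With t1 = Im z and t2 = -Im tau this is
  half of the block of \<open>g11_matrix\<close> for (Im tau, Im z); the block for the real parts
  repeats it on the connector parts. The obstacle is that connection, connector and J are given by
  \<open>SOME\<close> and \<open>THE\<close>: each needs a witness and uniqueness, the connection
  only for smooth fields at points of \<open>gauss_dom\<close>, before any formula can be used.
  Moreover the bijection of the theorem lives on densities and is computed only over
  \<open>T_gauss_dom\<close>, so maps are compared on open sets throughout.\<close>

lemma Ck_on_cong:
  fixes f g :: "'a::real_normed_vector \<Rightarrow> 'b::real_normed_vector"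
  assumes "open S" and eq: "\<And>x. x \<in> S \<Longrightarrow> f x = g x" and "Ck_on k S f"
  shows "Ck_on k S g"
  using assms(2,3)
proof (induction k arbitrary: f g)
  case 0
  then show ?case by (simp cong: continuous_on_cong)
next
  case (Suc k)
  have der: "(g has_derivative frechet_derivative f (at x)) (at x)" if "x \<in> S" for x
  proof (rule has_derivative_transform_within_open[OF _ \<open>open S\<close> that])
    show "(f has_derivative frechet_derivative f (at x)) (at x)"
      using Suc.prems(2) that by (simp add: frechet_derivative_works)
  qed (use Suc.prems(1) in auto)
  have "frechet_derivative f (at x) v = frechet_derivative g (at x) v" if "x \<in> S" for x v
    using frechet_derivative_at[OF der[OF that]] by simp
  then have "Ck_on k S (\<lambda>x. frechet_derivative g (at x) v)" for v
    by (rule Suc.IH) (use Suc.prems(2) in simp_all)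
  then show ?case
    using der by (auto simp: differentiable_def)
qed

text \<open>The inductions for sums, products, inverses and roots go through this rule: an explicit
  derivative \<open>f'\<close> takes the place of \<open>frechet_derivative\<close>, which agrees
  with it only on \<open>S\<close>.\<close>

lemma Ck_on_Suc_if_has_derivative:
  fixes f :: "'a::real_normed_vector \<Rightarrow> 'b::real_normed_vector"
  assumes "open S"
    and der: "\<And>x. x \<in> S \<Longrightarrow> (f has_derivative f' x) (at x)"
    and Ck: "\<And>v. Ck_on k S (\<lambda>x. f' x v)"
  shows "Ck_on (Suc k) S f"
proof -
  have "f' x v = frechet_derivative f (at x) v" if "x \<in> S" for x v
    using frechet_derivative_at[OF der[OF that]] by simp
  then have "Ck_on k S (\<lambda>x. frechet_derivative f (at x) v)" for v
    by (rule Ck_on_cong[OF \<open>open S\<close> _ Ck])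
  then show ?thesis
    using der by (auto simp: differentiable_def)
qed

text \<open>The recursive definition asks for differentiability and for regular derivatives, not for
  regularity of \<open>f\<close> itself at the lower order. The product, inverse and root rules need
  the latter, since undifferentiated factors survive in their derivatives.\<close>

lemma Ck_on_SucD:
  assumes "Ck_on (Suc k) S f"
  shows "Ck_on k S f"
  using assms
proof (induction k arbitrary: f)
  case 0
  then have "f differentiable_on S"
    unfolding differentiable_on_def by (auto intro: differentiable_at_withinI)
  then show ?case
    by (simp add: differentiable_imp_continuous_on)
next
  case (Suc k)
  note Ck = Suc.prems[unfolded Ck_on.simps(2)[of "Suc k"]]
  have "Ck_on k S (\<lambda>x. frechet_derivative f (at x) v)" for v
    by (rule Suc.IH) (use Ck in blast)
  with Ck show ?case by simp
qed

lemma Ck_on_Suc_has_derivative: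
  assumes "Ck_on (Suc k) S f" "x \<in> S"
  shows "(f has_derivative frechet_derivative f (at x)) (at x)"
  using assms by (simp add: frechet_derivative_works)

lemma Ck_on_const: "open S \<Longrightarrow> Ck_on k S (\<lambda>_. c)"
  by (induction k arbitrary: c) (auto simp: frechet_derivative_const)

lemma (in bounded_linear) Ck_on:
  assumes "open S" "Ck_on k S g"
  shows "Ck_on k S (\<lambda>x. f (g x))"
  using assms(2)
proof (induction k arbitrary: g)
  case 0
  then show ?case by (simp add: continuous_on)
next
  case (Suc k)
  show ?case
  proof (rule Ck_on_Suc_if_has_derivative[OF \<open>open S\<close>])
    show "((\<lambda>x. f (g x)) has_derivative (\<lambda>v. f (frechet_derivative g (at x) v))) (at x)"
      if "x \<in> S" for x
      by (rule has_derivative[OF Ck_on_Suc_has_derivative[OF Suc.prems that]])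
    show "Ck_on k S (\<lambda>x. f (frechet_derivative g (at x) v))" for v
      by (rule Suc.IH) (use Suc.prems in simp)
  qed
qed

lemma Ck_on_add:
  assumes "open S" "Ck_on k S f" "Ck_on k S g"
  shows "Ck_on k S (\<lambda>x. f x + g x)"
  using assms(2,3)
proof (induction k arbitrary: f g)
  case 0
  then show ?case by (simp add: continuous_on_add)
next
  case (Suc k)
  show ?case
  proof (rule Ck_on_Suc_if_has_derivative[OF \<open>open S\<close>])
    show "((\<lambda>x. f x + g x) has_derivative
        (\<lambda>v. frechet_derivative f (at x) v + frechet_derivative g (at x) v)) (at x)"
      if "x \<in> S" for x
      by (rule has_derivative_add[OF Ck_on_Suc_has_derivative Ck_on_Suc_has_derivative]) (fact Suc.prems that)+
    show "Ck_on k S (\<lambda>x. frechet_derivative f (at x) v + frechet_derivative g (at x) v)" for v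
      by (rule Suc.IH) (use Suc.prems in simp_all)
  qed
qed

lemma (in bounded_bilinear) Ck_on:
  assumes "open S" "Ck_on k S f" "Ck_on k S g"
  shows "Ck_on k S (\<lambda>x. prod (f x) (g x))"
  using assms(2,3)
proof (induction k arbitrary: f g)
  case 0
  then show ?case by (simp add: continuous_on)
next
  case (Suc k)
  have Ck: "Ck_on k S f" "Ck_on k S g"
    using Suc.prems by (auto intro: Ck_on_SucD simp del: Ck_on.simps)
  show ?case
  proof (rule Ck_on_Suc_if_has_derivative[OF \<open>open S\<close>])
    show "((\<lambda>x. prod (f x) (g x)) has_derivative
        (\<lambda>v. prod (f x) (frechet_derivative g (at x) v) + prod (frechet_derivative f (at x) v) (g x))) (at x)"
      if "x \<in> S" for x
      by (rule FDERIV[OF Ck_on_Suc_has_derivative Ck_on_Suc_has_derivative]) (fact Suc.prems that)+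
    show "Ck_on k S (\<lambda>x. prod (f x) (frechet_derivative g (at x) v) + prod (frechet_derivative f (at x) v) (g x))" for v
      by (intro Ck_on_add[OF \<open>open S\<close>] Suc.IH Ck) (use Suc.prems in simp_all)
  qed
qed

text \<open>The derivative of 1/f is built from 1/f and the derivative of f, so regularity of 1/f at
  order k yields order k + 1. The function \<open>f\<close> stays fixed in the induction.\<close>

lemma Ck_on_inverse:
  fixes f :: "'a::real_normed_vector \<Rightarrow> real"
  assumes "open S" "Ck_on k S f" and nz: "\<And>x. x \<in> S \<Longrightarrow> f x \<noteq> 0"
  shows "Ck_on k S (\<lambda>x. inverse (f x))"
  using assms(2)
proof (induction k)
  case 0
  then show ?case using nz by (simp add: continuous_on_inverse)
next
  case (Suc k)
  define f' where "f' x v = - (inverse (f x) * frechet_derivative f (at x) v * inverse (f x))" for x v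
  note Ck = Suc.IH[OF Ck_on_SucD[OF Suc.prems]]
  \<comment> \<open>Negation is written as a product with -1, so that the bilinear rule covers the
    whole term.\<close>
  have "Ck_on k S (\<lambda>x. (- 1) * (inverse (f x) * frechet_derivative f (at x) v * inverse (f x)))" for v
    by (intro bounded_bilinear.Ck_on[OF bounded_bilinear_mult \<open>open S\<close>] Ck
        Ck_on_const[OF \<open>open S\<close>]) (use Suc.prems in simp)
  then have "Ck_on k S (\<lambda>x. f' x v)" for v
    by (simp add: f'_def)
  moreover have "((\<lambda>x. inverse (f x)) has_derivative f' x) (at x)" if "x \<in> S" for x
    using Deriv.has_derivative_inverse[OF nz[OF that] Ck_on_Suc_has_derivative[OF Suc.prems that]]
    unfolding f'_def .
  ultimately show ?case
    by (intro Ck_on_Suc_if_has_derivative[OF \<open>open S\<close>, where f' = f'])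
qed

lemma Ck_on_sqrt:
  fixes f :: "'a::real_normed_vector \<Rightarrow> real"
  assumes "open S" "Ck_on k S f" and pos: "\<And>x. x \<in> S \<Longrightarrow> f x > 0"
  shows "Ck_on k S (\<lambda>x. sqrt (f x))"
  using assms(2)
proof (induction k)
  case 0
  then show ?case by (simp add: continuous_on_real_sqrt)
next
  case (Suc k)
  define f' where "f' x v = frechet_derivative f (at x) v * (inverse (sqrt (f x)) / 2)" for x v
  have sqrt_nz: "sqrt (f x) \<noteq> 0" if "x \<in> S" for x
    using pos[OF that] by simp
  have "Ck_on k S (\<lambda>x. inverse (sqrt (f x)))"
    by (rule Ck_on_inverse[OF \<open>open S\<close> Suc.IH[OF Ck_on_SucD[OF Suc.prems]] sqrt_nz])
  then have "Ck_on k S (\<lambda>x. frechet_derivative f (at x) v * (inverse (sqrt (f x)) * (1 / 2)))" for v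
    by (intro bounded_bilinear.Ck_on[OF bounded_bilinear_mult \<open>open S\<close>]
        Ck_on_const[OF \<open>open S\<close>]) (use Suc.prems in simp)
  then have "Ck_on k S (\<lambda>x. f' x v)" for v
    by (simp add: f'_def)
  moreover have "((\<lambda>x. sqrt (f x)) has_derivative f' x) (at x)" if "x \<in> S" for x
    using has_derivative_compose[OF Ck_on_Suc_has_derivative[OF Suc.prems that]
        DERIV_real_sqrt[OF pos[OF that], unfolded has_field_derivative_def]]
    unfolding f'_def by (simp add: mult.commute)
  ultimately show ?case
    by (intro Ck_on_Suc_if_has_derivative[OF \<open>open S\<close>, where f' = f'])
qed

section \<open>Closure properties of \<open>smooth_on\<close>\<close>

lemma smooth_onI: "(\<And>k. Ck_on k S f) \<Longrightarrow> smooth_on S f"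
  by (simp add: smooth_on_def)

lemma smooth_onD: "smooth_on S f \<Longrightarrow> Ck_on k S f"
  by (simp add: smooth_on_def)

lemma smooth_on_has_derivative:
  "smooth_on S f \<Longrightarrow> x \<in> S \<Longrightarrow> (f has_derivative frechet_derivative f (at x)) (at x)"
  by (rule Ck_on_Suc_has_derivative[OF smooth_onD])

lemma smooth_on_frechet_derivative:
  assumes "smooth_on S f"
  shows "smooth_on S (\<lambda>x. frechet_derivative f (at x) v)"
proof (rule smooth_onI)
  show "Ck_on k S (\<lambda>x. frechet_derivative f (at x) v)" for k
    using smooth_onD[OF assms, of "Suc k"] by simp
qed

lemma smooth_on_cong:
  "open S \<Longrightarrow> (\<And>x. x \<in> S \<Longrightarrow> f x = g x) \<Longrightarrow> smooth_on S f \<Longrightarrow> smooth_on S g"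
  unfolding smooth_on_def by (metis Ck_on_cong)

lemma smooth_on_const: "open S \<Longrightarrow> smooth_on S (\<lambda>_. c)"
  by (simp add: smooth_on_def Ck_on_const)

lemma smooth_on_add:
  "open S \<Longrightarrow> smooth_on S f \<Longrightarrow> smooth_on S g \<Longrightarrow> smooth_on S (\<lambda>x. f x + g x)"
  by (simp add: smooth_on_def Ck_on_add)

lemma (in bounded_linear) smooth_on_compose:
  "open S \<Longrightarrow> smooth_on S g \<Longrightarrow> smooth_on S (\<lambda>x. f (g x))"
  by (simp add: smooth_on_def Ck_on)

lemma (in bounded_linear) smooth_on: "open S \<Longrightarrow> smooth_on S f"
proof (intro smooth_onI)
  fix k
  assume "open S"
  show "Ck_on k S f"
  proof (cases k)
    case 0
    then show ?thesis by (simp add: linear_continuous_on bounded_linear_axioms)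
  next
    case (Suc j)
    show ?thesis
      unfolding Suc
      by (rule Ck_on_Suc_if_has_derivative[OF \<open>open S\<close>, where f' = "\<lambda>_. f"])
        (auto intro: bounded_linear_imp_has_derivative bounded_linear_axioms Ck_on_const \<open>open S\<close>)
  qed
qed

lemma smooth_on_scaleR:
  "open S \<Longrightarrow> smooth_on S f \<Longrightarrow> smooth_on S g \<Longrightarrow> smooth_on S (\<lambda>x. f x *\<^sub>R g x)"
  by (simp add: smooth_on_def bounded_bilinear.Ck_on[OF bounded_bilinear_scaleR])

lemma smooth_on_mult:
  fixes f g :: "'a::real_normed_vector \<Rightarrow> real"
  shows "open S \<Longrightarrow> smooth_on S f \<Longrightarrow> smooth_on S g \<Longrightarrow> smooth_on S (\<lambda>x. f x * g x)"
  by (simp add: smooth_on_def bounded_bilinear.Ck_on[OF bounded_bilinear_mult])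

lemma smooth_on_diff:
  fixes f g :: "'a::real_normed_vector \<Rightarrow> 'b::real_normed_vector"
  assumes "open S" "smooth_on S f" "smooth_on S g"
  shows "smooth_on S (\<lambda>x. f x - g x)"
  using smooth_on_add[OF assms(1,2) bounded_linear.smooth_on_compose[OF bounded_linear_minus
        [OF bounded_linear_ident] assms(1,3)]] by simp

lemma smooth_on_divide:
  fixes f g :: "'a::real_normed_vector \<Rightarrow> real"
  assumes "open S" "smooth_on S f" "smooth_on S g" "\<And>x. x \<in> S \<Longrightarrow> g x \<noteq> 0"
  shows "smooth_on S (\<lambda>x. f x / g x)"
proof -
  have "smooth_on S (\<lambda>x. inverse (g x))"
    using assms by (simp add: smooth_on_def Ck_on_inverse)
  then show ?thesis
    using assms by (simp add: divide_inverse smooth_on_mult)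
qed

lemma smooth_on_power:
  fixes f :: "'a::real_normed_vector \<Rightarrow> real"
  assumes "open S" "smooth_on S f"
  shows "smooth_on S (\<lambda>x. f x ^ n)"
  by (induction n) (auto intro: assms smooth_on_const smooth_on_mult)

lemma smooth_on_sqrt:
  fixes f :: "'a::real_normed_vector \<Rightarrow> real"
  shows "open S \<Longrightarrow> smooth_on S f \<Longrightarrow> (\<And>x. x \<in> S \<Longrightarrow> f x > 0) \<Longrightarrow> smooth_on S (\<lambda>x. sqrt (f x))"
  by (simp add: smooth_on_def Ck_on_sqrt)

lemma smooth_on_Pair:
  assumes "open S" "smooth_on S f" "smooth_on S g"
  shows "smooth_on S (\<lambda>x. (f x, g x))"
proof -
  have "bounded_linear (\<lambda>y. (y, 0))" "bounded_linear (\<lambda>y. (0, y))"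
    by (intro bounded_linear_Pair bounded_linear_ident bounded_linear_zero)+
  then have "smooth_on S (\<lambda>x. (f x, 0) + (0, g x))"
    using assms by (intro smooth_on_add bounded_linear.smooth_on_compose[of "\<lambda>y. (y, 0)"]
        bounded_linear.smooth_on_compose[of "\<lambda>y. (0, y)"])
  then show ?thesis by simp
qed

lemma smooth_on_Complex:
  assumes "open S" "smooth_on S f" "smooth_on S g"
  shows "smooth_on S (\<lambda>x. Complex (f x) (g x))"
proof -
  have "smooth_on S (\<lambda>x. f x *\<^sub>R 1 + g x *\<^sub>R \<i>)"
    by (intro smooth_on_add smooth_on_scaleR smooth_on_const assms)
  then show ?thesis by (simp add: Complex_eq scaleR_conv_of_real mult.commute)
qed

lemma smooth_on_fst: "open S \<Longrightarrow> smooth_on S f \<Longrightarrow> smooth_on S (\<lambda>x. fst (f x))"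
  by (rule bounded_linear.smooth_on_compose[OF bounded_linear_fst])

lemma smooth_on_snd: "open S \<Longrightarrow> smooth_on S f \<Longrightarrow> smooth_on S (\<lambda>x. snd (f x))"
  by (rule bounded_linear.smooth_on_compose[OF bounded_linear_snd])

lemma smooth_on_ident: "open S \<Longrightarrow> smooth_on S (\<lambda>x. x)"
  by (rule bounded_linear.smooth_on[OF bounded_linear_ident])

lemma smooth_on_Re: "open S \<Longrightarrow> smooth_on S f \<Longrightarrow> smooth_on S (\<lambda>x. Re (f x))"
  by (rule bounded_linear.smooth_on_compose[OF bounded_linear_Re])

lemma smooth_on_Im: "open S \<Longrightarrow> smooth_on S f \<Longrightarrow> smooth_on S (\<lambda>x. Im (f x))"
  by (rule bounded_linear.smooth_on_compose[OF bounded_linear_Im])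

section \<open>Connections in coordinates\<close>

lemma smooth_on_sum:
  assumes "open S" "\<And>i. i \<in> I \<Longrightarrow> smooth_on S (f i)"
  shows "smooth_on S (\<lambda>x. \<Sum>i\<in>I. f i x)"
  using assms(2)
  by (induction I rule: infinite_finite_induct) (auto intro: \<open>open S\<close> smooth_on_const smooth_on_add)

lemma smooth_on_inner_const:
  "open S \<Longrightarrow> smooth_on S f \<Longrightarrow> smooth_on S (\<lambda>x. f x \<bullet> c)"
  by (rule bounded_linear.smooth_on_compose[OF bounded_linear_inner_left])

lemma smooth_on_linear_frechet_derivative:
  "smooth_on S f \<Longrightarrow> x \<in> S \<Longrightarrow> linear (frechet_derivative f (at x))"
  by (rule has_derivative_linear[OF smooth_on_has_derivative])

text \<open>Smoothness only provides derivatives in a fixed direction. For a direction that varies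
  with the point, \<open>X x\<close> is expanded in the basis and linearity of the derivative is
  used.\<close>

lemma smooth_on_directional_derivative:
  fixes X :: "'a::euclidean_space \<Rightarrow> 'a"
  assumes "open S" "smooth_on S X" "smooth_on S Y"
  shows "smooth_on S (\<lambda>x. frechet_derivative Y (at x) (X x))"
proof -
  have eq: "(\<Sum>i\<in>Basis. (X x \<bullet> i) *\<^sub>R frechet_derivative Y (at x) i) = frechet_derivative Y (at x) (X x)"
    if "x \<in> S" for x
  proof -
    interpret D: linear "frechet_derivative Y (at x)"
      by (rule smooth_on_linear_frechet_derivative[OF assms(3) that])
    show ?thesis
      using D.sum[of "\<lambda>i. (X x \<bullet> i) *\<^sub>R i" Basis] by (simp add: D.scale euclidean_representation)
  qed
  show ?thesis
    by (rule smooth_on_cong[OF \<open>open S\<close> eq])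
      (assumption | intro smooth_on_sum smooth_on_scaleR smooth_on_inner_const smooth_on_frechet_derivative assms)+
qed

text \<open>The Leibniz term comes from the flat derivative alone, since \<open>\<Gamma>\<close> is
  bilinear at each point. This supplies the witness for the choice of the exponential
  connection.\<close>

lemma affine_connection_christoffel:
  fixes U :: "'a::euclidean_space set"
  assumes "open U"
    and bil: "\<And>p. p \<in> U \<Longrightarrow> bilinear (\<Gamma> p)"
    and smooth: "\<And>X Y. smooth_on U X \<Longrightarrow> smooth_on U Y \<Longrightarrow> smooth_on U (\<lambda>p. \<Gamma> p (X p) (Y p))"
  shows "affine_connection U (\<lambda>X Y p. frechet_derivative Y (at p) (X p) + \<Gamma> p (X p) (Y p))"
  unfolding affine_connection_def
proof (intro conjI allI impI ballI)
  fix X Y :: "'a \<Rightarrow> 'a"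
  assume XY: "smooth_on U X" "smooth_on U Y"
  show "smooth_on U (\<lambda>p. frechet_derivative Y (at p) (X p) + \<Gamma> p (X p) (Y p))"
    by (intro smooth_on_add smooth_on_directional_derivative smooth XY \<open>open U\<close>)
next
  fix X X' Y :: "'a \<Rightarrow> 'a" and p
  assume "smooth_on U Y" and p: "p \<in> U"
  then interpret D: linear "frechet_derivative Y (at p)"
    by (rule smooth_on_linear_frechet_derivative)
  show "frechet_derivative Y (at p) (X p + X' p) + \<Gamma> p (X p + X' p) (Y p) =
      frechet_derivative Y (at p) (X p) + \<Gamma> p (X p) (Y p) +
      (frechet_derivative Y (at p) (X' p) + \<Gamma> p (X' p) (Y p))"
    by (simp add: D.add bilinear_ladd[OF bil[OF p]])
next
  fix X Y Y' :: "'a \<Rightarrow> 'a" and p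
  assume Y: "smooth_on U Y" "smooth_on U Y'" and p: "p \<in> U"
  have "frechet_derivative (\<lambda>q. Y q + Y' q) (at p) =
      (\<lambda>v. frechet_derivative Y (at p) v + frechet_derivative Y' (at p) v)"
    by (intro frechet_derivative_at[symmetric] has_derivative_add smooth_on_has_derivative[OF _ p] Y)
  then show "frechet_derivative (\<lambda>q. Y q + Y' q) (at p) (X p) + \<Gamma> p (X p) (Y p + Y' p) =
      frechet_derivative Y (at p) (X p) + \<Gamma> p (X p) (Y p) +
      (frechet_derivative Y' (at p) (X p) + \<Gamma> p (X p) (Y' p))"
    by (simp add: bilinear_radd[OF bil[OF p]])
next
  fix f :: "'a \<Rightarrow> real" and X Y :: "'a \<Rightarrow> 'a" and p
  assume "smooth_on U Y" and p: "p \<in> U"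
  then interpret D: linear "frechet_derivative Y (at p)"
    by (intro smooth_on_linear_frechet_derivative)
  show "frechet_derivative Y (at p) (f p *\<^sub>R X p) + \<Gamma> p (f p *\<^sub>R X p) (Y p) =
      f p *\<^sub>R (frechet_derivative Y (at p) (X p) + \<Gamma> p (X p) (Y p))"
    by (simp add: D.scale bilinear_lmul[OF bil[OF p]] scaleR_add_right)
next
  fix f :: "'a \<Rightarrow> real" and X Y :: "'a \<Rightarrow> 'a" and p
  assume f: "smooth_on U f" and Y: "smooth_on U Y" and p: "p \<in> U"
  have "frechet_derivative (\<lambda>q. f q *\<^sub>R Y q) (at p) =
      (\<lambda>v. f p *\<^sub>R frechet_derivative Y (at p) v + frechet_derivative f (at p) v *\<^sub>R Y p)"
    by (intro frechet_derivative_at[symmetric] has_derivative_scaleR smooth_on_has_derivative[OF _ p] f Y)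
  then show "frechet_derivative (\<lambda>q. f q *\<^sub>R Y q) (at p) (X p) + \<Gamma> p (X p) (f p *\<^sub>R Y p) =
      frechet_derivative f (at p) (X p) *\<^sub>R Y p +
      f p *\<^sub>R (frechet_derivative Y (at p) (X p) + \<Gamma> p (X p) (Y p))"
    by (simp add: bilinear_rmul[OF bil[OF p]] scaleR_add_right)
qed

section \<open>Affine connections are determined by the constant basis fields\<close>

context
  fixes U :: "'a::euclidean_space set" and nabla
  assumes conn: "affine_connection U nabla" and U: "open U"
begin

lemma affine_connection_add_left:
  "smooth_on U X \<Longrightarrow> smooth_on U X' \<Longrightarrow> smooth_on U Y \<Longrightarrow> p \<in> U \<Longrightarrow>
    nabla (\<lambda>q. X q + X' q) Y p = nabla X Y p + nabla X' Y p"
  using conn unfolding affine_connection_def by (elim conjE) blast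

lemma affine_connection_add_right:
  "smooth_on U X \<Longrightarrow> smooth_on U Y \<Longrightarrow> smooth_on U Y' \<Longrightarrow> p \<in> U \<Longrightarrow>
    nabla X (\<lambda>q. Y q + Y' q) p = nabla X Y p + nabla X Y' p"
  using conn unfolding affine_connection_def by (elim conjE) blast

lemma affine_connection_scale_left:
  "smooth_on U f \<Longrightarrow> smooth_on U X \<Longrightarrow> smooth_on U Y \<Longrightarrow> p \<in> U \<Longrightarrow>
    nabla (\<lambda>q. f q *\<^sub>R X q) Y p = f p *\<^sub>R nabla X Y p"
  using conn unfolding affine_connection_def by (elim conjE) blast

lemma affine_connection_scale_right:
  "smooth_on U f \<Longrightarrow> smooth_on U X \<Longrightarrow> smooth_on U Y \<Longrightarrow> p \<in> U \<Longrightarrow>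
    nabla X (\<lambda>q. f q *\<^sub>R Y q) p = frechet_derivative f (at p) (X p) *\<^sub>R Y p + f p *\<^sub>R nabla X Y p"
  using conn unfolding affine_connection_def by (elim conjE) blast

lemma affine_connection_sum_left:
  assumes "finite I" "\<And>i. i \<in> I \<Longrightarrow> smooth_on U (f i)" "smooth_on U Y" "p \<in> U"
  shows "nabla (\<lambda>q. \<Sum>i\<in>I. f i q *\<^sub>R i) Y p = (\<Sum>i\<in>I. f i p *\<^sub>R nabla (\<lambda>_. i) Y p)"
  using assms(1,2)
proof (induction I rule: finite_induct)
  case empty
  show ?case
    \<comment> \<open>The empty sum is the zero field, which is 0 times itself; function linearity
      then gives the value 0.\<close>
    using affine_connection_scale_left[of "\<lambda>_. 0" "\<lambda>_. 0" Y p] assms(3,4)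
    by (simp add: smooth_on_const U)
next
  case (insert i I)
  have "smooth_on U (\<lambda>q. f i q *\<^sub>R i)" "smooth_on U (\<lambda>q. \<Sum>i\<in>I. f i q *\<^sub>R i)"
    using insert.prems by (auto intro!: smooth_on_sum smooth_on_scaleR smooth_on_const U)
  then have "nabla (\<lambda>q. f i q *\<^sub>R i + (\<Sum>i\<in>I. f i q *\<^sub>R i)) Y p =
      nabla (\<lambda>q. f i q *\<^sub>R i) Y p + nabla (\<lambda>q. \<Sum>i\<in>I. f i q *\<^sub>R i) Y p"
    using assms(3,4) by (intro affine_connection_add_left)
  moreover have "nabla (\<lambda>q. f i q *\<^sub>R i) Y p = f i p *\<^sub>R nabla (\<lambda>_. i) Y p"
    using insert.prems assms(3,4)
    by (intro affine_connection_scale_left) (auto intro: smooth_on_const U)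
  ultimately show ?case
    using insert.hyps insert.IH insert.prems by simp
qed

lemma affine_connection_sum_right:
  assumes "finite I" "\<And>i. i \<in> I \<Longrightarrow> smooth_on U (f i)" "smooth_on U X" "p \<in> U"
  shows "nabla X (\<lambda>q. \<Sum>i\<in>I. f i q *\<^sub>R i) p =
    (\<Sum>i\<in>I. frechet_derivative (f i) (at p) (X p) *\<^sub>R i + f i p *\<^sub>R nabla X (\<lambda>_. i) p)"
  using assms(1,2)
proof (induction I rule: finite_induct)
  case empty
  show ?case
    using affine_connection_scale_right[of "\<lambda>_. 0" X "\<lambda>_. 0" p] assms(3,4)
    by (simp add: smooth_on_const U)
next
  case (insert i I)
  have "smooth_on U (\<lambda>q. f i q *\<^sub>R i)" "smooth_on U (\<lambda>q. \<Sum>i\<in>I. f i q *\<^sub>R i)"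
    using insert.prems by (auto intro!: smooth_on_sum smooth_on_scaleR smooth_on_const U)
  then have "nabla X (\<lambda>q. f i q *\<^sub>R i + (\<Sum>i\<in>I. f i q *\<^sub>R i)) p =
      nabla X (\<lambda>q. f i q *\<^sub>R i) p + nabla X (\<lambda>q. \<Sum>i\<in>I. f i q *\<^sub>R i) p"
    using assms(3,4) by (intro affine_connection_add_right)
  moreover have "nabla X (\<lambda>q. f i q *\<^sub>R i) p =
      frechet_derivative (f i) (at p) (X p) *\<^sub>R i + f i p *\<^sub>R nabla X (\<lambda>_. i) p"
    using insert.prems assms(3,4)
    by (intro affine_connection_scale_right) (auto intro: smooth_on_const U)
  ultimately show ?case
    using insert.hyps insert.IH insert.prems by simp
qed

text \<open>Expanding \<open>X\<close> uses function linearity in the first slot, expanding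
  \<open>Y\<close> the Leibniz rule in the second; the Leibniz terms add up to the derivative of
  \<open>Y\<close>. Defining equations stated for coordinate fields thus reach all smooth
  fields.\<close>

lemma affine_connection_eq_christoffel:
  assumes X: "smooth_on U X" and Y: "smooth_on U Y" and p: "p \<in> U" and bil: "bilinear \<Gamma>"
    and \<Gamma>: "\<And>i j. i \<in> Basis \<Longrightarrow> j \<in> Basis \<Longrightarrow> nabla (\<lambda>_. i) (\<lambda>_. j) p = \<Gamma> i j"
  shows "nabla X Y p = frechet_derivative Y (at p) (X p) + \<Gamma> (X p) (Y p)"
proof -
  have const: "nabla X (\<lambda>_. j) p = \<Gamma> (X p) j" if "j \<in> Basis" for j
  proof -
    \<comment> \<open>The expansion is an equality of functions on the whole space, so it may be
      substituted inside \<open>nabla\<close>.\<close>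
    have "nabla X (\<lambda>_. j) p = nabla (\<lambda>q. \<Sum>i\<in>Basis. (X q \<bullet> i) *\<^sub>R i) (\<lambda>_. j) p"
      by (simp add: euclidean_representation)
    also have "\<dots> = (\<Sum>i\<in>Basis. (X p \<bullet> i) *\<^sub>R \<Gamma> i j)"
      using affine_connection_sum_left[OF finite_Basis, of "\<lambda>i q. X q \<bullet> i" "\<lambda>_. j" p]
        smooth_on_inner_const[OF U X] p \<Gamma> that by (simp add: smooth_on_const U)
    also have "\<dots> = \<Gamma> (\<Sum>i\<in>Basis. (X p \<bullet> i) *\<^sub>R i) j"
    proof -
      interpret linear "\<lambda>v. \<Gamma> v j" using bil by (simp add: bilinear_def)
      show ?thesis by (simp add: sum scale)
    qed
    finally show ?thesis by (simp add: euclidean_representation)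
  qed
  have D: "frechet_derivative (\<lambda>q. Y q \<bullet> j) (at p) v = frechet_derivative Y (at p) v \<bullet> j" for j v
    using frechet_derivative_at[OF has_derivative_inner_left[OF smooth_on_has_derivative[OF Y p]]]
    by metis
  have "nabla X Y p = nabla X (\<lambda>q. \<Sum>j\<in>Basis. (Y q \<bullet> j) *\<^sub>R j) p"
    by (simp add: euclidean_representation)
  also have "\<dots> = (\<Sum>j\<in>Basis. (frechet_derivative Y (at p) (X p) \<bullet> j) *\<^sub>R j + (Y p \<bullet> j) *\<^sub>R \<Gamma> (X p) j)"
    using affine_connection_sum_right[OF finite_Basis, of "\<lambda>j q. Y q \<bullet> j" X p]
      smooth_on_inner_const[OF U Y] X p const D by simp
  also have "\<dots> = frechet_derivative Y (at p) (X p) + (\<Sum>j\<in>Basis. (Y p \<bullet> j) *\<^sub>R \<Gamma> (X p) j)"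
    by (simp add: sum.distrib euclidean_representation)
  also have "(\<Sum>j\<in>Basis. (Y p \<bullet> j) *\<^sub>R \<Gamma> (X p) j) = \<Gamma> (X p) (\<Sum>j\<in>Basis. (Y p \<bullet> j) *\<^sub>R j)"
  proof -
    interpret linear "\<lambda>w. \<Gamma> (X p) w" using bil by (simp add: bilinear_def)
    show ?thesis by (simp add: sum scale)
  qed
  finally show ?thesis by (simp add: euclidean_representation)
qed

end

text \<open>Uniqueness is the point. Test fields fix \<open>K\<close> only on graphs of linear maps,
  which contain no nonzero vertical vector; linearity of \<open>K\<close> recovers the vertical
  vectors as differences of two graph vectors over the same base vector.\<close>

lemma connector_eq:
  fixes U :: "'a::euclidean_space set"
  assumes U: "open U" and p: "p \<in> U" and lin: "linear (\<lambda>v. \<Gamma> v u)"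
    and nabla: "\<And>X Y. smooth_on U X \<Longrightarrow> smooth_on U Y \<Longrightarrow>
      nabla X Y p = frechet_derivative Y (at p) (X p) + \<Gamma> (X p) (Y p)"
  shows "connector U nabla (p, u) = (\<lambda>A. snd A + \<Gamma> (fst A) u)"
proof -
  have D: "frechet_derivative (\<lambda>q. (q, Y q)) (at p) = (\<lambda>v. (v, frechet_derivative Y (at p) v))"
    if "smooth_on U Y" for Y :: "'a \<Rightarrow> 'a"
    using frechet_derivative_at[OF has_derivative_Pair[OF has_derivative_ident
          smooth_on_has_derivative[OF that p]]] by simp
  show ?thesis
    unfolding connector_def prod.case
  proof (rule the_equality)
    interpret linear "\<lambda>v. \<Gamma> v u" by (rule lin)
    have "linear (\<lambda>A. snd A + \<Gamma> (fst A) u)"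
      by (intro linearI) (simp_all add: add scale scaleR_add_right)
    then show "linear (\<lambda>A. snd A + \<Gamma> (fst A) u) \<and> (\<forall>X Y. smooth_on U X \<longrightarrow> smooth_on U Y \<longrightarrow> Y p = u \<longrightarrow>
        nabla X Y p = snd (frechet_derivative (\<lambda>q. (q, Y q)) (at p) (X p)) +
          \<Gamma> (fst (frechet_derivative (\<lambda>q. (q, Y q)) (at p) (X p))) u)"
      using nabla D by simp
  next
    fix K
    assume K: "linear K \<and> (\<forall>X Y. smooth_on U X \<longrightarrow> smooth_on U Y \<longrightarrow> Y p = u \<longrightarrow>
        nabla X Y p = K (frechet_derivative (\<lambda>q. (q, Y q)) (at p) (X p)))"
    then interpret K: linear K by blast
    have K_graph: "K (v, L v) = L v + \<Gamma> v u" if "bounded_linear L" for v L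
    proof -
      interpret L: bounded_linear L by (rule that)
      \<comment> \<open>An affine field can take the value \<open>u\<close> at \<open>p\<close> and
        have any prescribed derivative \<open>L\<close>.\<close>
      define Y where "Y q = (u - L p) + L q" for q
      have Y: "smooth_on U Y" "Y p = u"
        unfolding Y_def by (intro smooth_on_add smooth_on_const L.smooth_on U) simp
      have "(Y has_derivative L) (at p)"
        unfolding Y_def by (auto intro!: derivative_eq_intros L.has_derivative)
      then have "frechet_derivative Y (at p) = L"
        by (rule frechet_derivative_at[symmetric])
      then show ?thesis
        using K[THEN conjunct2, rule_format, OF smooth_on_const[OF U] Y, of v]
          nabla[OF smooth_on_const[OF U] Y(1), of v] by (simp add: D[OF Y(1)] Y(2))
    qed
    have K_fst: "K (v, 0) = \<Gamma> v u" for v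
      using K_graph[OF bounded_linear_zero] by simp
    have K_snd: "K (0, w) = w" for w
    proof -
      obtain i :: 'a where i: "i \<in> Basis" using nonempty_Basis by blast
      \<comment> \<open>This linear map sends the unit vector \<open>i\<close> to \<open>w\<close>,
        so (0, w) = (i, w) - (i, 0) is a difference of vectors already treated.\<close>
      have "bounded_linear (\<lambda>v. (v \<bullet> i) *\<^sub>R w)"
        by (intro bounded_linear_scaleR_const bounded_linear_inner_left)
      from K_graph[OF this, of i] have "K (i, w) = w + \<Gamma> i u"
        using i by (simp add: inner_Basis)
      then show ?thesis
        using K.diff[of "(i, w)" "(i, 0)"] K_fst[of i] by simp
    qed
    show "K = (\<lambda>A. snd A + \<Gamma> (fst A) u)"
    proof
      fix A
      show "K A = snd A + \<Gamma> (fst A) u"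
        using K.add[of "(fst A, 0)" "(0, snd A)"] K_fst K_snd by simp
    qed
  qed
qed

text \<open>The map A to (\<open>fst A\<close>, K A) is invertible: once the base part of B is - K
  A, the equation K B = \<open>fst A\<close> can be solved for \<open>snd B\<close>.\<close>

lemma dombrowski_J_eq:
  assumes "connector U nabla (p, u) = (\<lambda>A. snd A + \<Gamma> (fst A) u)" "linear (\<lambda>v. \<Gamma> v u)"
  shows "dombrowski_J U nabla (p, u) A =
    (- connector U nabla (p, u) A, fst A + \<Gamma> (connector U nabla (p, u) A) u)"
  unfolding dombrowski_J_def prod.case
proof (rule the_equality)
  show "fst (- connector U nabla (p, u) A, fst A + \<Gamma> (connector U nabla (p, u) A) u) =
      - connector U nabla (p, u) A \<and>
      connector U nabla (p, u) (- connector U nabla (p, u) A, fst A + \<Gamma> (connector U nabla (p, u) A) u) =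
      fst A"
    using linear_neg[OF assms(2), of "connector U nabla (p, u) A"] by (simp add: assms(1))
next
  fix B
  assume B: "fst B = - connector U nabla (p, u) A \<and> connector U nabla (p, u) B = fst A"
  have "connector U nabla (p, u) B = snd B + \<Gamma> (fst B) u"
    by (simp add: assms(1))
  with B have "fst A = snd B - \<Gamma> (connector U nabla (p, u) A) u"
    using linear_neg[OF assms(2), of "connector U nabla (p, u) A"] by (metis diff_conv_add_uminus)
  then show "B = (- connector U nabla (p, u) A, fst A + \<Gamma> (connector U nabla (p, u) A) u)"
    using B by (cases B) (simp add: algebra_simps)
qed

section \<open>The Fisher metric and the exponential connection of the Gaussians\<close>

lemma expect_gauss: "expect gauss (\<mu>, \<sigma>) f = (LINT x|lborel. normal_density \<mu> \<sigma> x * f x)"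
  if "f \<in> borel_measurable borel"
  unfolding expect_def gauss_def using that
  by (subst integral_density) (auto simp: normal_density_nonneg)

text \<open>All integrands below are polynomials of degree at most four in x - \<mu>. The central
  moments of order 0 to 4 are 1, 0, \<sigma>^2, 0 and 3 \<sigma>^4, with 3 = 4!/(2^2 * 2!).\<close>

lemma expect_gauss_quartic:
  assumes "\<sigma> > 0"
    and f: "\<And>x. f x = c0 + c1 * (x - \<mu>) + c2 * (x - \<mu>)^2 + c3 * (x - \<mu>)^3 + c4 * (x - \<mu>)^4"
  shows "expect gauss (\<mu>, \<sigma>) f = c0 + c2 * \<sigma>\<^sup>2 + 3 * c4 * \<sigma>^4"
proof -
  let ?n = "normal_density \<mu> \<sigma>"
  have m: "has_bochner_integral lborel (\<lambda>x. ?n x * (x - \<mu>) ^ k) (LINT x|lborel. ?n x * (x - \<mu>) ^ k)" for k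
    using integrable_normal_moment[OF \<open>\<sigma> > 0\<close>] has_bochner_integral_integrable by blast
  have moments: "(LINT x|lborel. ?n x * (x - \<mu>) ^ 0) = 1" "(LINT x|lborel. ?n x * (x - \<mu>) ^ 1) = 0"
      "(LINT x|lborel. ?n x * (x - \<mu>) ^ 2) = \<sigma>\<^sup>2" "(LINT x|lborel. ?n x * (x - \<mu>) ^ 3) = 0"
      "(LINT x|lborel. ?n x * (x - \<mu>) ^ 4) = 3 * \<sigma>^4"
    using integral_normal_moment_even[OF \<open>\<sigma> > 0\<close>, of \<mu> 0] integral_normal_moment_odd[OF \<open>\<sigma> > 0\<close>, of \<mu> 0]
      integral_normal_moment_even[OF \<open>\<sigma> > 0\<close>, of \<mu> 1] integral_normal_moment_odd[OF \<open>\<sigma> > 0\<close>, of \<mu> 1]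
      integral_normal_moment_even[OF \<open>\<sigma> > 0\<close>, of \<mu> 2]
    by (simp_all add: fact_numeral power_divide)
  have "has_bochner_integral lborel (\<lambda>x. ((((?n x * (x - \<mu>) ^ 0) * c0 + (?n x * (x - \<mu>) ^ 1) * c1) +
      (?n x * (x - \<mu>) ^ 2) * c2) + (?n x * (x - \<mu>) ^ 3) * c3) + (?n x * (x - \<mu>) ^ 4) * c4)
     ((((1 * c0 + 0 * c1) + \<sigma>\<^sup>2 * c2) + 0 * c3) + (3 * \<sigma>^4) * c4)"
    using m[of 0] m[of 1] m[of 2] m[of 3] m[of 4] unfolding moments
    by (intro has_bochner_integral_add has_bochner_integral_mult_left)
  moreover have "(\<lambda>x. ((((?n x * (x - \<mu>) ^ 0) * c0 + (?n x * (x - \<mu>) ^ 1) * c1) +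
      (?n x * (x - \<mu>) ^ 2) * c2) + (?n x * (x - \<mu>) ^ 3) * c3) + (?n x * (x - \<mu>) ^ 4) * c4) = (\<lambda>x. ?n x * f x)"
    by (simp add: f algebra_simps)
  ultimately have "(LINT x|lborel. ?n x * f x) = c0 + c2 * \<sigma>\<^sup>2 + 3 * c4 * \<sigma>^4"
    by (simp add: has_bochner_integral_integral_eq mult.commute)
  moreover have "f \<in> borel_measurable borel"
    unfolding f[abs_def] by measurable
  ultimately show ?thesis
    by (simp add: expect_gauss)
qed

lemma open_gauss_dom: "open gauss_dom"
proof -
  have "gauss_dom = snd -` {0<..}" by (auto simp: gauss_dom_def)
  then show ?thesis by (metis open_vimage_snd open_greaterThan)
qed

lemma ln_normal_density:
  "\<sigma> > 0 \<Longrightarrow> ln (normal_density \<mu> \<sigma> x) = - (ln \<sigma> + ln (2 * pi) / 2) - (x - \<mu>)\<^sup>2 / (2 * \<sigma>\<^sup>2)"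
  by (simp add: normal_density_def ln_mult ln_div ln_sqrt ln_realpow field_simps)

lemma dlog_gauss:
  assumes "\<sigma> > 0"
  shows "dlog gauss v (\<mu>, \<sigma>) x = fst v * ((x - \<mu>) / \<sigma>\<^sup>2) + snd v * ((x - \<mu>)\<^sup>2 / \<sigma>^3 - 1 / \<sigma>)"
proof -
  let ?D = "\<lambda>v. fst v * ((x - \<mu>) / \<sigma>\<^sup>2) + snd v * ((x - \<mu>)\<^sup>2 / \<sigma>^3 - 1 / \<sigma>)"
  have "((\<lambda>\<eta>. - (ln (snd \<eta>) + ln (2 * pi) / 2) - (x - fst \<eta>)\<^sup>2 / (2 * (snd \<eta>)\<^sup>2)) has_derivative ?D) (at (\<mu>, \<sigma>))"
    using assms by (auto intro!: derivative_eq_intros ext simp: field_simps power2_eq_square power3_eq_cube)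
  \<comment> \<open>The closed form of the logarithm is available only for positive \<sigma>;
    openness of \<open>gauss_dom\<close> transfers its derivative.\<close>
  then have "((\<lambda>\<eta>. ln (gauss \<eta> x)) has_derivative ?D) (at (\<mu>, \<sigma>))"
    by (rule has_derivative_transform_within_open[OF _ open_gauss_dom])
      (use assms in \<open>auto simp: gauss_dom_def gauss_def ln_normal_density\<close>)
  then show ?thesis
    unfolding dlog_def by (simp add: frechet_derivative_at[symmetric])
qed

lemma ddlog_gauss:
  assumes "\<sigma> > 0"
  shows "ddlog gauss v w (\<mu>, \<sigma>) x =
    - (fst v * fst w) / \<sigma>\<^sup>2 - 2 * (fst v * snd w + snd v * fst w) * (x - \<mu>) / \<sigma>^3 +
    snd v * snd w * (1 / \<sigma>\<^sup>2 - 3 * (x - \<mu>)\<^sup>2 / \<sigma>^4)"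
proof -
  let ?D = "\<lambda>v. - (fst v * fst w) / \<sigma>\<^sup>2 - 2 * (fst v * snd w + snd v * fst w) * (x - \<mu>) / \<sigma>^3 +
    snd v * snd w * (1 / \<sigma>\<^sup>2 - 3 * (x - \<mu>)\<^sup>2 / \<sigma>^4)"
  have "((\<lambda>\<eta>. fst w * ((x - fst \<eta>) / (snd \<eta>)\<^sup>2) + snd w * ((x - fst \<eta>)\<^sup>2 / snd \<eta>^3 - 1 / snd \<eta>))
      has_derivative ?D) (at (\<mu>, \<sigma>))"
    using assms by (auto intro!: derivative_eq_intros ext simp: field_simps power2_eq_square power3_eq_cube power4_eq_xxxx)
  then have "((\<lambda>\<eta>. dlog gauss w \<eta> x) has_derivative ?D) (at (\<mu>, \<sigma>))"
    by (rule has_derivative_transform_within_open[OF _ open_gauss_dom])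
      (use assms in \<open>auto simp: gauss_dom_def dlog_gauss\<close>)
  then show ?thesis
    unfolding ddlog_def by (simp add: frechet_derivative_at[symmetric])
qed

lemma expect_dlog_dlog_gauss:
  assumes "\<sigma> > 0"
  shows "expect gauss (\<mu>, \<sigma>) (\<lambda>x. dlog gauss v (\<mu>, \<sigma>) x * dlog gauss w (\<mu>, \<sigma>) x) =
    (fst v * fst w + 2 * (snd v * snd w)) / \<sigma>\<^sup>2"
  \<comment> \<open>The coefficients come from expanding the product of two scores in powers of x -
    \<mu>. The factor 2 in the result is 1 - 2 + 3, from the orders 0, 2 and 4.\<close>
  by (subst expect_gauss_quartic[OF assms, where
        ?c0.0 = "snd v * snd w / \<sigma>\<^sup>2" and
        ?c1.0 = "- (fst v * snd w + snd v * fst w) / \<sigma>^3" and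
        ?c2.0 = "(fst v * fst w - 2 * (snd v * snd w)) / \<sigma>^4" and
        ?c3.0 = "(fst v * snd w + snd v * fst w) / \<sigma>^5" and
        ?c4.0 = "snd v * snd w / \<sigma>^6"])
    (use assms in \<open>simp_all add: dlog_gauss field_simps eval_nat_numeral\<close>)

lemma expect_ddlog_dlog_gauss:
  assumes "\<sigma> > 0"
  shows "expect gauss (\<mu>, \<sigma>) (\<lambda>x. ddlog gauss u v (\<mu>, \<sigma>) x * dlog gauss w (\<mu>, \<sigma>) x) =
    - (2 * (fst u * snd v + snd u * fst v) * fst w + 6 * (snd u * snd v) * snd w) / \<sigma>^3"
  \<comment> \<open>Again the expansion in powers of x - \<mu>. The coefficient -6 is -1 + 4 - 9,
    and the terms in \<open>fst u * fst v * snd w\<close> cancel between the orders 0 and 2.\<close>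
  by (subst expect_gauss_quartic[OF assms, where
        ?c0.0 = "(fst u * fst v - snd u * snd v) * snd w / \<sigma>^3" and
        ?c1.0 = "(- fst u * fst v * fst w + snd u * snd v * fst w
          + 2 * (fst u * snd v + snd u * fst v) * snd w) / \<sigma>^4" and
        ?c2.0 = "(- fst u * fst v * snd w - 2 * (fst u * snd v + snd u * fst v) * fst w
          + 4 * (snd u * snd v * snd w)) / \<sigma>^5" and
        ?c3.0 = "(- 2 * (fst u * snd v + snd u * fst v) * snd w - 3 * (snd u * snd v * fst w)) / \<sigma>^6" and
        ?c4.0 = "- 3 * (snd u * snd v * snd w) / \<sigma>^7"])
    (use assms in \<open>simp_all add: dlog_gauss ddlog_gauss field_simps eval_nat_numeral\<close>)

lemma Basis_real_prod: "(Basis :: (real \<times> real) set) = {(1, 0), (0, 1)}"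
  by (auto simp: Basis_prod_def)

lemma fisher_metric_gauss:
  assumes "\<sigma> > 0"
  shows "fisher_metric gauss (\<mu>, \<sigma>) v w = (fst v * fst w + 2 * (snd v * snd w)) / \<sigma>\<^sup>2"
  unfolding fisher_metric_def expect_dlog_dlog_gauss[OF assms]
  by (simp add: Basis_real_prod inner_prod_def add_divide_distrib)

text \<open>Raising the index of the expectations above with the inverse metric \<sigma>^2 diag(1,
  1/2) turns -2/\<sigma>^3 and -6/\<sigma>^3 into -2/\<sigma> and -3/\<sigma>.\<close>

definition gauss_christoffel :: "real \<times> real \<Rightarrow> real \<times> real \<Rightarrow> real \<times> real \<Rightarrow> real \<times> real" where
  "gauss_christoffel p v w =
    (- 2 / snd p * (fst v * snd w + snd v * fst w), - 3 / snd p * (snd v * snd w))"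

lemma bilinear_gauss_christoffel: "bilinear (gauss_christoffel p)"
  unfolding bilinear_def gauss_christoffel_def
  by (intro conjI allI linearI) (simp_all add: algebra_simps add_divide_distrib diff_divide_distrib)

lemma fisher_metric_gauss_christoffel:
  assumes "\<sigma> > 0"
  shows "fisher_metric gauss (\<mu>, \<sigma>) (gauss_christoffel (\<mu>, \<sigma>) u v) w =
    expect gauss (\<mu>, \<sigma>) (\<lambda>x. ddlog gauss u v (\<mu>, \<sigma>) x * dlog gauss w (\<mu>, \<sigma>) x)"
  unfolding fisher_metric_gauss[OF assms] expect_ddlog_dlog_gauss[OF assms] gauss_christoffel_def
  using assms by (simp add: field_simps power2_eq_square power3_eq_cube)

lemma frechet_derivative_const_field: "frechet_derivative (\<lambda>_. c) (at p) v = 0"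
  by (simp add: frechet_derivative_const)

text \<open>This witness makes the \<open>SOME\<close> in \<open>exponential_connection\<close>
  satisfy its specification. On constant fields the derivative vanishes and only the Christoffel
  term is left.\<close>

lemma is_exponential_connection_gauss:
  "is_exponential_connection gauss_dom gauss
    (\<lambda>X Y p. frechet_derivative Y (at p) (X p) + gauss_christoffel p (X p) (Y p))"
  unfolding is_exponential_connection_def
proof (intro conjI ballI)
  have "smooth_on gauss_dom (\<lambda>p. gauss_christoffel p (X p) (Y p))"
    if "smooth_on gauss_dom X" "smooth_on gauss_dom Y" for X Y
    unfolding gauss_christoffel_def
    by (intro smooth_on_Pair smooth_on_mult smooth_on_divide smooth_on_add smooth_on_const
        smooth_on_fst smooth_on_snd smooth_on_ident that open_gauss_dom)
      (auto simp: gauss_dom_def)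
  then show "affine_connection gauss_dom
      (\<lambda>X Y p. frechet_derivative Y (at p) (X p) + gauss_christoffel p (X p) (Y p))"
    by (intro affine_connection_christoffel open_gauss_dom bilinear_gauss_christoffel)
next
  fix \<xi> i j k :: "real \<times> real"
  assume "\<xi> \<in> gauss_dom"
  then show "fisher_metric gauss \<xi> (frechet_derivative (\<lambda>_. j) (at \<xi>) i + gauss_christoffel \<xi> i j) k =
      expect gauss \<xi> (\<lambda>x. ddlog gauss i j \<xi> x * dlog gauss k \<xi> x)"
    by (cases \<xi>) (simp add: gauss_dom_def frechet_derivative_const_field fisher_metric_gauss_christoffel)
qed

lemma exponential_connection_gauss:
  assumes X: "smooth_on gauss_dom X" and Y: "smooth_on gauss_dom Y" and p: "p \<in> gauss_dom"
  shows "exponential_connection gauss_dom gauss X Y p =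
    frechet_derivative Y (at p) (X p) + gauss_christoffel p (X p) (Y p)"
proof -
  let ?nabla = "exponential_connection gauss_dom gauss"
  have exp: "is_exponential_connection gauss_dom gauss ?nabla"
    unfolding exponential_connection_def by (rule someI[of "is_exponential_connection gauss_dom gauss"])
      (rule is_exponential_connection_gauss)
  obtain \<mu> \<sigma> where p_eq: "p = (\<mu>, \<sigma>)" and \<sigma>: "\<sigma> > 0"
    using p by (auto simp: gauss_dom_def)
  have "?nabla (\<lambda>_. i) (\<lambda>_. j) p = gauss_christoffel p i j" if "i \<in> Basis" "j \<in> Basis" for i j
  proof -
    have eq: "fisher_metric gauss p (?nabla (\<lambda>_. i) (\<lambda>_. j) p) k =
        fisher_metric gauss p (gauss_christoffel p i j) k" if "k \<in> Basis" for k
      using exp p that \<open>i \<in> Basis\<close> \<open>j \<in> Basis\<close> fisher_metric_gauss_christoffel[OF \<sigma>, of \<mu> i j k]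
      unfolding is_exponential_connection_def p_eq by auto
    show ?thesis
      \<comment> \<open>Nondegeneracy: the metric is diagonal with positive entries, so pairing with
        the two basis vectors recovers both components.\<close>
      using eq[of "(1, 0)"] eq[of "(0, 1)"] \<sigma>
      by (simp add: Basis_real_prod p_eq fisher_metric_gauss prod_eq_iff)
  qed
  then show ?thesis
    using exp X Y p open_gauss_dom bilinear_gauss_christoffel
    unfolding is_exponential_connection_def by (intro affine_connection_eq_christoffel) auto
qed

section \<open>The isomorphism\<close>

lemma linear_gauss_christoffel: "linear (\<lambda>v. gauss_christoffel p v u)"
  using bilinear_gauss_christoffel unfolding bilinear_def by blast

section \<open>Both Kaehler structures in explicit coordinates\<close>

lemma connector_gauss:
  "p \<in> gauss_dom \<Longrightarrow> connector gauss_dom (exponential_connection gauss_dom gauss) (p, u) =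
    (\<lambda>A. snd A + gauss_christoffel p (fst A) u)"
  by (rule connector_eq[OF open_gauss_dom _ linear_gauss_christoffel exponential_connection_gauss])

lemma T_gauss_J_eq:
  "p \<in> gauss_dom \<Longrightarrow> T_gauss_J (p, u) A =
    (- (snd A + gauss_christoffel p (fst A) u),
     fst A + gauss_christoffel p (snd A + gauss_christoffel p (fst A) u) u)"
  unfolding T_gauss_J_def
  by (subst dombrowski_J_eq[OF connector_gauss linear_gauss_christoffel]) (simp_all only: connector_gauss)

lemma T_gauss_metric_eq:
  "p \<in> gauss_dom \<Longrightarrow> T_gauss_metric (p, u) A B =
    fisher_metric gauss p (fst A) (fst B) +
    fisher_metric gauss p (snd A + gauss_christoffel p (fst A) u) (snd B + gauss_christoffel p (fst B) u)"
  unfolding T_gauss_metric_def dombrowski_metric_def by (simp add: connector_gauss)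

lemma vector_4_nth:
  "vector [a, b, c, d] $ (1::4) = (a::'a::zero)" "vector [a, b, c, d] $ (2::4) = b"
  "vector [a, b, c, d] $ (3::4) = c" "vector [a, b, c, d] $ (4::4) = d"
  unfolding vector_def by simp_all

text \<open>The coefficients multiply the real parts of \<open>a * cnj c\<close>,
  \<open>a * cnj d + b * cnj c\<close> and \<open>b * cnj d\<close>, which exhibits the metric as
  Hermitian.\<close>

lemma g_KB_eq:
  "g_KB (\<tau>, z) (a, b) (c, d) =
    ((Im \<tau> + (Im z)\<^sup>2) / Im \<tau>^3 * (Re a * Re c + Im a * Im c)
      - Im z / (Im \<tau>)\<^sup>2 * (Re a * Re d + Im a * Im d + Re b * Re c + Im b * Im c)
      + (Re b * Re d + Im b * Im d) / Im \<tau>) / 2"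
  unfolding g_KB_def g11_matrix_def real_coords_def
  by (simp add: Let_def inner_vec_def matrix_vector_mult_def sum_4 vector_4_nth algebra_simps
      add_divide_distrib diff_divide_distrib)

definition gauss_to_SJ :: "(real \<times> real) \<times> (real \<times> real) \<Rightarrow> complex \<times> complex" where
  "gauss_to_SJ q =
    (Complex (snd (snd q) / snd (fst q) ^ 3) (1 / (2 * (snd (fst q))\<^sup>2)),
     Complex (2 * fst (fst q) * snd (snd q) / snd (fst q) ^ 3 - fst (snd q) / (snd (fst q))\<^sup>2)
       (fst (fst q) / (snd (fst q))\<^sup>2))"

text \<open>Inverse of \<open>gauss_to_SJ\<close>: 2 Im tau = 1/\<sigma>^2 gives \<sigma>, then
  \<mu> = \<sigma>^2 Im z and b = \<sigma>^3 Re tau, and finally a = \<sigma>^2 (2 \<mu> Re tau - Re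
  z).\<close>

definition SJ_to_gauss :: "complex \<times> complex \<Rightarrow> (real \<times> real) \<times> (real \<times> real)" where
  "SJ_to_gauss w =
    ((Im (snd w) / (2 * Im (fst w)), 1 / sqrt (2 * Im (fst w))),
     ((Re (fst w) * Im (snd w) / Im (fst w) - Re (snd w)) / (2 * Im (fst w)),
      Re (fst w) / sqrt (2 * Im (fst w)) ^ 3))"

lemma T_gauss_dom_iff: "q \<in> T_gauss_dom \<longleftrightarrow> snd (fst q) > 0"
  by (cases q) (auto simp: T_gauss_dom_def gauss_dom_def)

lemma siegel_jacobi_iff: "w \<in> siegel_jacobi \<longleftrightarrow> Im (fst w) > 0"
  by (cases w) (auto simp: siegel_jacobi_def)

lemma gauss_to_SJ_in: "q \<in> T_gauss_dom \<Longrightarrow> gauss_to_SJ q \<in> siegel_jacobi"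
  by (simp add: T_gauss_dom_iff siegel_jacobi_iff gauss_to_SJ_def)

lemma SJ_to_gauss_in: "w \<in> siegel_jacobi \<Longrightarrow> SJ_to_gauss w \<in> T_gauss_dom"
  by (simp add: T_gauss_dom_iff siegel_jacobi_iff SJ_to_gauss_def)

lemma SJ_to_gauss_to_SJ:
  assumes "q \<in> T_gauss_dom"
  shows "SJ_to_gauss (gauss_to_SJ q) = q"
proof -
  obtain \<mu> \<sigma> a b where q: "q = ((\<mu>, \<sigma>), (a, b))" by (metis surj_pair)
  have \<sigma>: "\<sigma> > 0" using assms by (simp add: q T_gauss_dom_iff)
  then have "sqrt (1 / \<sigma>\<^sup>2) = 1 / \<sigma>" by (simp add: real_sqrt_divide)
  with \<sigma> show ?thesis
    by (simp add: q SJ_to_gauss_def gauss_to_SJ_def field_simps power2_eq_square power3_eq_cube)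
qed

lemma gauss_to_SJ_to_gauss:
  assumes "w \<in> siegel_jacobi"
  shows "gauss_to_SJ (SJ_to_gauss w) = w"
proof -
  obtain u v x y where w: "w = (Complex u v, Complex x y)" by (metis surj_pair complex.exhaust_sel)
  have v: "v > 0" using assms by (simp add: w siegel_jacobi_iff)
  \<comment> \<open>With v = s^2/2 the identity becomes rational in \<open>s\<close>, and no root is
    left to simplify.\<close>
  define s where "s = sqrt (2 * v)"
  have s: "s > 0" "v = s\<^sup>2 / 2" using v by (simp_all add: s_def)
  show ?thesis
    unfolding w SJ_to_gauss_def gauss_to_SJ_def fst_conv snd_conv complex.sel s_def[symmetric]
    unfolding s(2) using s(1) by (simp add: field_simps power2_eq_square power3_eq_cube)
qed

lemma bij_betw_gauss_to_SJ: "bij_betw gauss_to_SJ T_gauss_dom siegel_jacobi"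
  by (rule bij_betwI[of _ _ _ SJ_to_gauss])
    (simp_all add: gauss_to_SJ_in SJ_to_gauss_in SJ_to_gauss_to_SJ gauss_to_SJ_to_gauss)

lemma open_T_gauss_dom: "open T_gauss_dom"
  unfolding T_gauss_dom_def by (intro open_Times open_gauss_dom open_UNIV)

lemma open_siegel_jacobi: "open siegel_jacobi"
  unfolding siegel_jacobi_def by (intro open_Times open_halfspace_Im_gt open_UNIV)

lemma smooth_on_gauss_to_SJ: "smooth_on T_gauss_dom gauss_to_SJ"
  unfolding gauss_to_SJ_def[abs_def]
  by (intro smooth_on_Pair smooth_on_Complex smooth_on_mult smooth_on_divide smooth_on_diff
      smooth_on_power smooth_on_const smooth_on_fst smooth_on_snd smooth_on_ident open_T_gauss_dom)
    (auto simp: T_gauss_dom_iff)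

lemma smooth_on_SJ_to_gauss: "smooth_on siegel_jacobi SJ_to_gauss"
  unfolding SJ_to_gauss_def[abs_def]
  by (intro smooth_on_Pair smooth_on_mult smooth_on_divide smooth_on_diff smooth_on_sqrt
      smooth_on_power smooth_on_const smooth_on_fst smooth_on_snd smooth_on_Re smooth_on_Im
      smooth_on_ident open_siegel_jacobi)
    (auto simp: siegel_jacobi_iff)

text \<open>The canonical inverse agrees with \<open>SJ_to_gauss\<close> on the open set
  \<open>siegel_jacobi\<close>, and this is enough to inherit its smoothness.\<close>

lemma diffeomorphism_gauss_to_SJ: "diffeomorphism T_gauss_dom siegel_jacobi gauss_to_SJ"
proof -
  have inj: "inj_on gauss_to_SJ T_gauss_dom"
    using bij_betw_gauss_to_SJ by (rule bij_betw_imp_inj_on)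
  have "SJ_to_gauss w = the_inv_into T_gauss_dom gauss_to_SJ w" if "w \<in> siegel_jacobi" for w
    using the_inv_into_f_f[OF inj SJ_to_gauss_in[OF that]] gauss_to_SJ_to_gauss[OF that] by simp
  then show ?thesis
    unfolding diffeomorphism_def
    using bij_betw_gauss_to_SJ smooth_on_gauss_to_SJ
      smooth_on_cong[OF open_siegel_jacobi _ smooth_on_SJ_to_gauss] by blast
qed

lemma has_derivative_Complex:
  assumes "(f has_derivative f') F" "(g has_derivative g') F"
  shows "((\<lambda>x. Complex (f x) (g x)) has_derivative (\<lambda>h. Complex (f' h) (g' h))) F"
proof -
  have "((\<lambda>x. f x *\<^sub>R 1 + g x *\<^sub>R \<i>) has_derivative (\<lambda>h. f' h *\<^sub>R 1 + g' h *\<^sub>R \<i>)) F"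
    by (intro has_derivative_add has_derivative_scaleR_left assms)
  then show ?thesis by (simp add: Complex_eq scaleR_conv_of_real mult.commute)
qed

text \<open>With \<open>K\<close> the connector, this differential is \<open>\<i> * L (fst A) - L (K A)\<close> for a real linear
  map \<open>L\<close>, which is why it turns \<open>(v, w) \<mapsto> (- w, v)\<close> into multiplication by \<open>\<i>\<close>.\<close>

lemma frechet_derivative_gauss_to_SJ:
  fixes \<mu> \<sigma> :: real and u :: "real \<times> real"
  assumes \<sigma>: "\<sigma> > 0"
  defines "K \<equiv> \<lambda>A. snd A + gauss_christoffel (\<mu>, \<sigma>) (fst A) u"
  shows "frechet_derivative gauss_to_SJ (at ((\<mu>, \<sigma>), u)) A =
    (Complex (snd (K A) / \<sigma>^3) (- snd (fst A) / \<sigma>^3),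
     Complex (2 * \<mu> * snd (K A) / \<sigma>^3 - fst (K A) / \<sigma>\<^sup>2)
       (fst (fst A) / \<sigma>\<^sup>2 - 2 * \<mu> * snd (fst A) / \<sigma>^3))"
proof -
  obtain a b where u: "u = (a, b)" by (metis surj_pair)
  define q where "q = ((\<mu>, \<sigma>), u)"
  have [simp]: "fst (fst q) = \<mu>" "snd (fst q) = \<sigma>" "fst (snd q) = a" "snd (snd q) = b"
    by (simp_all add: q_def u)
  \<comment> \<open>Differentiating b/\<sigma>^3 gives (db - 3 b d\<sigma>/\<sigma>)/\<sigma>^3,
    whose bracket is the second component of \<open>K A\<close>.\<close>
  have 1: "((\<lambda>q. snd (snd q) / snd (fst q) ^ 3) has_derivative (\<lambda>A. snd (K A) / \<sigma>^3)) (at q)"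
    using \<sigma> by (auto intro!: derivative_eq_intros ext
        simp: K_def u gauss_christoffel_def field_simps power2_eq_square power3_eq_cube)
  have 2: "((\<lambda>q. 1 / (2 * (snd (fst q))\<^sup>2)) has_derivative (\<lambda>A. - snd (fst A) / \<sigma>^3)) (at q)"
    using \<sigma> by (auto intro!: derivative_eq_intros ext
        simp: field_simps power2_eq_square power3_eq_cube)
  \<comment> \<open>Besides \<open>K\<close>'s second component and da, the product rule leaves 2 (b
    d\<mu> + a d\<sigma>)/\<sigma>^3, which is the Christoffel part of - \<open>fst (K A)\<close> /
    \<sigma>^2.\<close>
  have 3: "((\<lambda>q. 2 * fst (fst q) * snd (snd q) / snd (fst q) ^ 3 - fst (snd q) / (snd (fst q))\<^sup>2)
      has_derivative (\<lambda>A. 2 * \<mu> * snd (K A) / \<sigma>^3 - fst (K A) / \<sigma>\<^sup>2)) (at q)"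
    using \<sigma> by (auto intro!: derivative_eq_intros ext
        simp: K_def u gauss_christoffel_def field_simps power2_eq_square power3_eq_cube)
  have 4: "((\<lambda>q. fst (fst q) / (snd (fst q))\<^sup>2)
      has_derivative (\<lambda>A. fst (fst A) / \<sigma>\<^sup>2 - 2 * \<mu> * snd (fst A) / \<sigma>^3)) (at q)"
    using \<sigma> by (auto intro!: derivative_eq_intros ext
        simp: field_simps power2_eq_square power3_eq_cube)
  show ?thesis
    using frechet_derivative_at[OF has_derivative_Pair[OF has_derivative_Complex[OF 1 2]
          has_derivative_Complex[OF 3 4]]]
    unfolding q_def[symmetric] gauss_to_SJ_def[abs_def] by metis
qed

lemma isometry_gauss_to_SJ:
  assumes "q \<in> T_gauss_dom"
  shows "g_KB (gauss_to_SJ q) (frechet_derivative gauss_to_SJ (at q) A)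
    (frechet_derivative gauss_to_SJ (at q) B) = T_gauss_metric q A B"
proof -
  obtain \<mu> \<sigma> u where q: "q = ((\<mu>, \<sigma>), u)" by (metis surj_pair)
  have \<sigma>: "\<sigma> > 0" and p: "(\<mu>, \<sigma>) \<in> gauss_dom"
    using assms by (simp_all add: q T_gauss_dom_iff gauss_dom_def)
  \<comment> \<open>Keeping \<open>K\<close> opaque reduces the claim to an identity in the
    components of \<open>fst A\<close>, \<open>fst B\<close>, \<open>K A\<close> and
    \<open>K B\<close>, without Christoffel terms.\<close>
  define K where "K A = snd A + gauss_christoffel (\<mu>, \<sigma>) (fst A) u" for A
  show ?thesis
    unfolding q frechet_derivative_gauss_to_SJ[OF \<sigma>] T_gauss_metric_eq[OF p]
      K_def[symmetric] fisher_metric_gauss[OF \<sigma>]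
    using \<sigma> by (simp add: gauss_to_SJ_def g_KB_eq field_simps power2_eq_square power3_eq_cube)
qed

text \<open>The differential sees \<open>A\<close> only through \<open>fst A\<close> and
  \<open>K A\<close>, and \<open>T_gauss_J\<close> replaces this pair by \<open>- K A\<close> and
  \<open>fst A\<close>.\<close>

lemma holomorphic_gauss_to_SJ:
  assumes "q \<in> T_gauss_dom"
  shows "frechet_derivative gauss_to_SJ (at q) (T_gauss_J q A) =
    J_SJ (gauss_to_SJ q) (frechet_derivative gauss_to_SJ (at q) A)"
proof -
  obtain \<mu> \<sigma> u where q: "q = ((\<mu>, \<sigma>), u)" by (metis surj_pair)
  have \<sigma>: "\<sigma> > 0" and p: "(\<mu>, \<sigma>) \<in> gauss_dom"
    using assms by (simp_all add: q T_gauss_dom_iff gauss_dom_def)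
  define K where "K A = snd A + gauss_christoffel (\<mu>, \<sigma>) (fst A) u" for A
  have "fst (T_gauss_J q A) = - K A" "K (T_gauss_J q A) = fst A"
    using linear_neg[OF linear_gauss_christoffel[of "(\<mu>, \<sigma>)" u], of "K A"]
    unfolding q T_gauss_J_eq[OF p] by (simp_all add: K_def)
  then show ?thesis
    unfolding q frechet_derivative_gauss_to_SJ[OF \<sigma>] K_def[symmetric]
    by (simp add: J_SJ_def complex_eq_iff)
qed

text \<open>Read backwards, holomorphy moves the complex structure inside the differential;
  preservation of the Kaehler form is then an instance of the isometry.\<close>

lemma biholomorphic_isometry_gauss_to_SJ:
  "biholomorphic_isometry T_gauss_dom T_gauss_metric T_gauss_J siegel_jacobi g_KB J_SJ gauss_to_SJ"
  unfolding biholomorphic_isometry_def Let_def kaehler_form_def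
  by (simp add: diffeomorphism_gauss_to_SJ isometry_gauss_to_SJ
      flip: holomorphic_gauss_to_SJ)

text \<open>The parameters are recovered as mean and standard deviation.\<close>

lemma inj_on_gauss: "inj_on gauss gauss_dom"
proof (rule inj_onI)
  fix p q
  assume pq: "p \<in> gauss_dom" "q \<in> gauss_dom" and eq: "gauss p = gauss q"
  obtain \<mu> \<sigma> \<mu>' \<sigma>' where p: "p = (\<mu>, \<sigma>)" and q: "q = (\<mu>', \<sigma>')" by (metis surj_pair)
  have \<sigma>: "\<sigma> > 0" "\<sigma>' > 0" using pq by (simp_all add: p q gauss_dom_def)
  have eq': "normal_density \<mu> \<sigma> = normal_density \<mu>' \<sigma>'"
    using eq by (simp add: p q gauss_def)
  have \<mu>: "\<mu> = \<mu>'"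
    using integral_normal_moment_nz_1[OF \<sigma>(1), of \<mu>] integral_normal_moment_nz_1[OF \<sigma>(2), of \<mu>']
    by (simp add: eq')
  have "\<sigma>\<^sup>2 = \<sigma>'\<^sup>2"
    using integral_normal_moment_even[OF \<sigma>(1), of \<mu> 1] integral_normal_moment_even[OF \<sigma>(2), of \<mu>' 1]
    by (simp add: eq'[unfolded \<mu>] \<mu>)
  then show "p = q"
    using \<sigma> by (simp add: p q \<mu> power2_eq_iff_nonneg)
qed

lemma bij_betw_T_gauss: "bij_betw T_gauss T_gauss_dom T_gaussians"
proof -
  have "bij_betw gauss gauss_dom gaussians"
    using inj_on_gauss by (auto simp: bij_betw_def gauss_def gauss_dom_def gaussians_def image_iff)
  then show ?thesis
    using bij_betw_map_prod[OF _ bij_betw_id, of gauss gauss_dom gaussians UNIV]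
    unfolding T_gauss_def T_gauss_dom_def T_gaussians_def map_prod_def id_def by simp
qed

text \<open>The composite with \<open>T_gauss\<close> is known only on \<open>T_gauss_dom\<close>.
  Agreement on an open domain preserves derivatives and smoothness.\<close>

lemma biholomorphic_isometry_cong:
  fixes G H :: "'a::real_normed_vector \<Rightarrow> 'b::real_normed_vector"
  assumes "open U" "open V" and eq: "\<And>q. q \<in> U \<Longrightarrow> G q = H q"
    and G: "biholomorphic_isometry U g J V g' J' G"
  shows "biholomorphic_isometry U g J V g' J' H"
proof -
  have G': "bij_betw G U V" "smooth_on U G" "smooth_on V (the_inv_into U G)"
    using G by (auto simp: biholomorphic_isometry_def diffeomorphism_def)
  \<comment> \<open>The description defining the inverse inspects only points of \<open>U\<close>,
    so the two inverses agree at every \<open>y\<close>, even outside \<open>V\<close>.\<close>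
  have "the_inv_into U G y = the_inv_into U H y" for y
    unfolding the_inv_into_def by (metis eq)
  then have "the_inv_into U G = the_inv_into U H" by blast
  then have "diffeomorphism U V H"
    using G' smooth_on_cong[OF \<open>open U\<close> eq G'(2)] bij_betw_cong[of U G H V] eq
    by (simp add: diffeomorphism_def)
  moreover have "frechet_derivative H (at q) = frechet_derivative G (at q)" if "q \<in> U" for q
    using has_derivative_transform_within_open[OF smooth_on_has_derivative[OF G'(2) that]
        \<open>open U\<close> that eq] by (metis frechet_derivative_at)
  ultimately show ?thesis
    using G eq by (simp add: biholomorphic_isometry_def Let_def)
qed

theorem proposition3p6:
  shows "\<exists>F :: (real \<Rightarrow> real) \<times> (real \<times> real) \<Rightarrow> complex \<times> complex.
    bij_betw F T_gaussians siegel_jacobi \<and>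
    biholomorphic_isometry T_gauss_dom T_gauss_metric T_gauss_J siegel_jacobi g_KB J_SJ (F \<circ> T_gauss)"
  proof -
  \<comment> \<open>Densities get their smooth structure from the global chart, so the map is read
    through the inverse of \<open>T_gauss\<close>.\<close>
  define F where "F = gauss_to_SJ \<circ> the_inv_into T_gauss_dom T_gauss"
  have F: "gauss_to_SJ q = (F \<circ> T_gauss) q" if "q \<in> T_gauss_dom" for q
    using the_inv_into_f_f[OF bij_betw_imp_inj_on[OF bij_betw_T_gauss] that] by (simp add: F_def)
  show ?thesis
  proof (intro exI conjI)
    show "bij_betw F T_gaussians siegel_jacobi"
      unfolding F_def
      by (rule bij_betw_trans[OF bij_betw_the_inv_into[OF bij_betw_T_gauss] bij_betw_gauss_to_SJ])
    show "biholomorphic_isometry T_gauss_dom T_gauss_metric T_gauss_J siegel_jacobi g_KB J_SJ (F \<circ> T_gauss)"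
      by (rule biholomorphic_isometry_cong[OF open_T_gauss_dom open_siegel_jacobi F
            biholomorphic_isometry_gauss_to_SJ])
  qed
qed

end
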